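(* Suppose $(PF)(x)\ge F(x)$ for all $x\in\mathbf X$, where $(PF)(x)=\int_{\mathbf X}F(y)\,P(dy\mid x)$, and let $\gamma\in(0,1]$ be fixed. Then the MDP $\{\mathbf S,\mathbf A,Q,c\}$ admits a $\gamma$-discounted optimal deterministic stationary policy $\varphi^\star_\gamma$ with the following threshold structure: for each $x\in\mathbf X$ there exists a threshold index $k^\star_\gamma(x)\in\mathbb N_0\cup\{\infty\}$ such that, for all $k\in\mathbb N_0$, $$\varphi^\star_\gamma(x,k)=\begin{cases} r & \text{if } k\ge k^\star_\gamma(x),\\ n & \text{if } k<k^\star_\gamma(x).\end{cases}$$ Equivalently, along each ray $\{(x,k):k\in\mathbb N_0\}$ the restart region $\{k\in\mathbb N_0:\varphi^\star_\gamma(x,k)=r\}$ is a tail set (possibly empty).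
   Context: Setting. $\mathbf X$ is a Borel space (with Borel $\sigma$-algebra $\mathcal B(\mathbf X)$), $P$ is a stochastic (Markov) kernel on $\mathbf X$ given $\mathbf X$, $\nu$ is a probability measure on $\mathbf X$, $F:\mathbf X\to[0,\infty]$ is measurable, and $G(n),G(r)\in[0,\infty)$ are constants. $\mathbb N_0=\{0,1,2,\dots\}$. $P^k$ is the $k$-fold composition of $P$ ($P^0$ is the identity kernel) and $(P^kF)(x)=\int_{\mathbf X}F(y)P^k(dy\mid x)$. The MDP $\{\mathbf S,\mathbf A,Q,c\}$ (the fully observed reduction of the Restart POMDP) has state space $\mathbf S=\mathbf X\times\mathbb N_0$ (last observed state, time elapsed since last restart), action space $\mathbf A=\{n,r\}$ ($n$: no intervention, $r$: restart), transition kernel $Q(dx'\times dk'\mid(x,k),n)=\delta_x(dx')\delta_{k+1}(dk')$, $Q(dx'\times dk'\mid(x,k),r)=\nu(dx')\delta_0(dk')$, and one-step cost $c(x,k;a)=(P^kF)(x)+G(a)$. A policy $\pi=\{\pi_t\}_{t\ge0}$ is a sequence of stochastic kernels $\pi_t$ on $\mathbf A$ given $(\mathbf S\times\mathbf A)^t\times\mathbf S$ (randomized, history-dependent); a deterministic stationary policy is identified with a measurable map $\varphi:\mathbf S\to\mathbf A$ (action $\varphi(s_t)$ is used at each time $t$). $\mathsf E^\pi_{x,k}$ is the expectation for the process $\{(S_t,A_t)\}$ of states and actions under $\pi$ started at $(x,k)$. For $\gamma\in(0,1]$ the $\gamma$-discounted cost is $V^\pi_\gamma(x,k)=\mathsf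 E^\pi_{x,k}\big[\sum_{t\ge0}\gamma^t c(S_t,A_t)\big]\in[0,\infty]$ ($\gamma=1$ is the total undiscounted cost), and $V_\gamma(x,k)=\inf_\pi V^\pi_\gamma(x,k)$. A policy $\pi^*$ is $\gamma$-discounted optimal if $V^{\pi^*}_\gamma(x,k)=V_\gamma(x,k)$ for all $(x,k)\in\mathbf S$. *)

theory Defs
  imports "HOL-Probability.Probability"
begin

definition history_space :: "'s measure \<Rightarrow> 'a measure \<Rightarrow> nat \<Rightarrow> ((nat \<Rightarrow> 's \<times> 'a) \<times> 's) measure" where
  "history_space S A t = PiM {0..<t} (\<lambda>_. S \<Otimes>\<^sub>M A) \<Otimes>\<^sub>M S"

type_synonym ('s, 'a) policy = "nat \<Rightarrow> (nat \<Rightarrow> 's \<times> 'a) \<times> 's \<Rightarrow> 'a measure"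

definition policies :: "'s measure \<Rightarrow> 'a measure \<Rightarrow> ('s, 'a) policy set" where
  "policies S A = {\<pi>. \<forall>t. \<pi> t \<in> history_space S A t \<rightarrow>\<^sub>M prob_algebra A}"

definition stationary_policy :: "'a measure \<Rightarrow> ('s \<Rightarrow> 'a) \<Rightarrow> ('s, 'a) policy" where
  "stationary_policy A \<phi> t h = return A (\<phi> (snd h))"

text \<open>The conditional law of \<open>(S\<^sub>t, A\<^sub>t)\<close> given the first \<open>t\<close> state-action pairs.\<close>

definition step_kernel ::
  "'s measure \<Rightarrow> 'a measure \<Rightarrow> ('s \<times> 'a \<Rightarrow> 's measure) \<Rightarrow> ('s, 'a) policy \<Rightarrow> 's
    \<Rightarrow> nat \<Rightarrow> (nat \<Rightarrow> 's \<times> 'a) \<Rightarrow> ('s \<times> 'a) measure" where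
  "step_kernel S A Q \<pi> s t \<omega> =
     (if t = 0 then return S s else Q (\<omega> (t - 1))) \<bind>
       (\<lambda>s'. \<pi> t (\<omega>, s') \<bind> (\<lambda>a. return (S \<Otimes>\<^sub>M A) (s', a)))"

text \<open>The law of \<open>(S\<^sub>t, A\<^sub>t)\<^sub>t\<close> on the trajectory space, given by the Ionescu-Tulcea theorem.\<close>

definition trajectory_measure ::
  "'s measure \<Rightarrow> 'a measure \<Rightarrow> ('s \<times> 'a \<Rightarrow> 's measure) \<Rightarrow> ('s, 'a) policy \<Rightarrow> 's
    \<Rightarrow> (nat \<Rightarrow> 's \<times> 'a) measure" where
  "trajectory_measure S A Q \<pi> s =
     projective_family.lim UNIV
       (Ionescu_Tulcea.CI (step_kernel S A Q \<pi> s) (\<lambda>_. S \<Otimes>\<^sub>M A)) (\<lambda>_. S \<Otimes>\<^sub>M A)"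

definition policy_cost ::
  "'s measure \<Rightarrow> 'a measure \<Rightarrow> ('s \<times> 'a \<Rightarrow> 's measure) \<Rightarrow> ('s \<times> 'a \<Rightarrow> ennreal) \<Rightarrow> real
    \<Rightarrow> ('s, 'a) policy \<Rightarrow> 's \<Rightarrow> ennreal" where
  "policy_cost S A Q c \<gamma> \<pi> s =
     (\<integral>\<^sup>+ \<omega>. (\<Sum>t. ennreal (\<gamma> ^ t) * c (\<omega> t)) \<partial>trajectory_measure S A Q \<pi> s)"

definition optimal_cost ::
  "'s measure \<Rightarrow> 'a measure \<Rightarrow> ('s \<times> 'a \<Rightarrow> 's measure) \<Rightarrow> ('s \<times> 'a \<Rightarrow> ennreal) \<Rightarrow> real
    \<Rightarrow> 's \<Rightarrow> ennreal" where
  "optimal_cost S A Q c \<gamma> s = (INF \<pi>\<in>policies S A. policy_cost S A Q c \<gamma> \<pi> s)"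

definition optimal_policy ::
  "'s measure \<Rightarrow> 'a measure \<Rightarrow> ('s \<times> 'a \<Rightarrow> 's measure) \<Rightarrow> ('s \<times> 'a \<Rightarrow> ennreal) \<Rightarrow> real
    \<Rightarrow> ('s, 'a) policy \<Rightarrow> bool" where
  "optimal_policy S A Q c \<gamma> \<pi> \<longleftrightarrow>
     \<pi> \<in> policies S A \<and>
     (\<forall>s\<in>space S. policy_cost S A Q c \<gamma> \<pi> s = optimal_cost S A Q c \<gamma> s)"

lemma stationary_policy_in_policies:
  assumes "\<phi> \<in> S \<rightarrow>\<^sub>M A"
  shows "stationary_policy A \<phi> \<in> policies S A"
  unfolding policies_def history_space_def stationary_policy_def
  using assms by (auto intro!: measurable_compose[OF _ measurable_return_prob_space])

text \<open>This justifies the use of \<^const>\<open>Ionescu_Tulcea.CI\<close> outside its locale.\<close>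

lemma Ionescu_Tulcea_step_kernel:
  assumes Q: "Q \<in> S \<Otimes>\<^sub>M A \<rightarrow>\<^sub>M prob_algebra S"
    and pol: "\<pi> \<in> policies S A" and s: "s \<in> space S"
  shows "Ionescu_Tulcea (step_kernel S A Q \<pi> s) (\<lambda>_. S \<Otimes>\<^sub>M A)"
proof -
  let ?H = "\<lambda>t. PiM {0..<t} (\<lambda>_. S \<Otimes>\<^sub>M A)"
  have pi: "\<pi> t \<in> ?H t \<Otimes>\<^sub>M S \<rightarrow>\<^sub>M prob_algebra A" for t
    using pol by (auto simp: policies_def history_space_def)
  have "step_kernel S A Q \<pi> s t \<in> ?H t \<rightarrow>\<^sub>M prob_algebra (S \<Otimes>\<^sub>M A)" for t
  proof -
    have 1: "(\<lambda>\<omega>. if t = 0 then return S s else Q (\<omega> (t - 1))) \<in> ?H t \<rightarrow>\<^sub>M prob_algebra S"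
    proof (cases "t = 0")
      case True
      then show ?thesis
        using s by (auto intro!: measurable_const simp: space_prob_algebra prob_space_return)
    next
      case False
      then have "(\<lambda>\<omega>. \<omega> (t - 1)) \<in> ?H t \<rightarrow>\<^sub>M S \<Otimes>\<^sub>M A"
        by (intro measurable_component_singleton) auto
      with False Q show ?thesis
        by (auto intro: measurable_compose)
    qed
    have 2: "(\<lambda>p. \<pi> t p \<bind> (\<lambda>a. return (S \<Otimes>\<^sub>M A) (snd p, a)))
        \<in> ?H t \<Otimes>\<^sub>M S \<rightarrow>\<^sub>M prob_algebra (S \<Otimes>\<^sub>M A)"
      by (rule measurable_bind_prob_space2[OF pi])
         (auto simp: case_prod_beta intro!: measurable_compose[OF _ measurable_return_prob_space])
    show ?thesis
      unfolding step_kernel_def[abs_def]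
      by (rule measurable_bind_prob_space2[OF 1]) (use 2 in \<open>simp add: case_prod_unfold\<close>)
  qed
  note K = this
  show ?thesis
    using K measurable_space[OF K]
    by (auto simp: Ionescu_Tulcea_def measurable_prob_algebraD space_prob_algebra)
qed

primrec kernel_power :: "'x measure \<Rightarrow> ('x \<Rightarrow> 'x measure) \<Rightarrow> nat \<Rightarrow> 'x \<Rightarrow> 'x measure" where
  "kernel_power M P 0 x = return M x"
| "kernel_power M P (Suc k) x = kernel_power M P k x \<bind> P"

datatype action = No_Intervention | Restart

abbreviation restart_states :: "'x measure \<Rightarrow> ('x \<times> nat) measure" where
  "restart_states M \<equiv> M \<Otimes>\<^sub>M count_space UNIV"

abbreviation restart_actions :: "action measure" where
  "restart_actions \<equiv> count_space UNIV"

fun restart_kernel ::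
  "'x measure \<Rightarrow> 'x measure \<Rightarrow> ('x \<times> nat) \<times> action \<Rightarrow> ('x \<times> nat) measure" where
  "restart_kernel M \<nu> ((x, k), No_Intervention) =
     return M x \<Otimes>\<^sub>M return (count_space UNIV) (Suc k)"
| "restart_kernel M \<nu> ((x, k), Restart) = \<nu> \<Otimes>\<^sub>M return (count_space UNIV) 0"

fun restart_cost ::
  "'x measure \<Rightarrow> ('x \<Rightarrow> 'x measure) \<Rightarrow> ('x \<Rightarrow> ennreal) \<Rightarrow> (action \<Rightarrow> real)
    \<Rightarrow> ('x \<times> nat) \<times> action \<Rightarrow> ennreal" where
  "restart_cost M P F G ((x, k), a) = (\<integral>\<^sup>+ y. F y \<partial>kernel_power M P k x) + ennreal (G a)"

lemma restart_kernel_measurable: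
  assumes nu: "\<nu> \<in> space (prob_algebra M)"
  shows "restart_kernel M \<nu> \<in> restart_states M \<Otimes>\<^sub>M restart_actions \<rightarrow>\<^sub>M prob_algebra (restart_states M)"
proof -
  have n: "(\<lambda>p. return M (fst p) \<Otimes>\<^sub>M return (count_space UNIV) (Suc (snd p)))
      \<in> restart_states M \<rightarrow>\<^sub>M prob_algebra (restart_states M)"
    by (intro measurable_pair_prob measurable_compose[OF _ measurable_return_prob_space]) auto
  have r: "(\<lambda>p. \<nu> \<Otimes>\<^sub>M return (count_space UNIV) 0)
      \<in> restart_states M \<rightarrow>\<^sub>M prob_algebra (restart_states M)"
    by (intro measurable_pair_prob measurable_compose[OF _ measurable_return_prob_space]
          measurable_const nu) auto
  have eq: "restart_kernel M \<nu> =
      (\<lambda>z. if snd z = No_Intervention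
           then return M (fst (fst z)) \<Otimes>\<^sub>M return (count_space UNIV) (Suc (snd (fst z)))
           else \<nu> \<Otimes>\<^sub>M return (count_space UNIV) 0)"
  proof
    fix z :: "('a \<times> nat) \<times> action"
    obtain x k a where "z = ((x, k), a)"
      by (metis surj_pair)
    then show "restart_kernel M \<nu> z = (if snd z = No_Intervention
           then return M (fst (fst z)) \<Otimes>\<^sub>M return (count_space UNIV) (Suc (snd (fst z)))
           else \<nu> \<Otimes>\<^sub>M return (count_space UNIV) 0)"
      by (cases a) simp_all
  qed
  show ?thesis
    unfolding eq
    by (intro measurable_If measurable_compose[OF measurable_fst n]
          measurable_compose[OF measurable_fst r]) measurable
qed

end

theory Submission
  imports Defs
begin

text \<open>
  Value iteration started at zero increases to a function \<open>v\<close>. Each iterate is a lower bound for the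
  cost of every policy, by telescoping the one-step inequality along the process up to the horizon
  of the iterate. Only two actions are available, so the minimum commutes with the increasing limit
  and \<open>v\<close> solves the optimality equation; telescoping that equation under a policy greedy for \<open>v\<close>
  shows that the policy costs at most \<open>v\<close>, hence is optimal. No convergence of the tail is needed, as
  costs are nonnegative, so the undiscounted case is included.

  Since \<open>F \<le> PF\<close>, the running cost \<open>P\<^sup>kF\<close> is nondecreasing in \<open>k\<close>, and so are all iterates and \<open>v\<close>.
  Restarting costs the same for all \<open>k\<close> up to the running cost, which is common to both actions, while
  waiting gets more expensive with \<open>k\<close>; hence the greedy restart region is a tail set.
\<close>

section \<open>Finite marginals of the trajectory measure\<close>

text \<open>The projective limit is accessible only through its finite marginals. The marginal on an
  initial segment is the composed kernel \<open>C 0 n\<close>, where recursion on \<open>n\<close>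
  is available.\<close>

lemma (in Ionescu_Tulcea) nn_integral_lim_restrict:
  assumes f[measurable]: "f \<in> borel_measurable (PiM {0..<n} M)"
  shows "(\<integral>\<^sup>+\<omega>. f (restrict \<omega> {0..<n}) \<partial>PF.lim) = (\<integral>\<^sup>+\<omega>. f \<omega> \<partial>C 0 n (\<lambda>_. undefined))"
proof -
  have r: "(\<lambda>\<omega>. restrict \<omega> {0..<n}) \<in> PF.lim \<rightarrow>\<^sub>M PiM {0..<n} M"
    unfolding measurable_cong_sets[OF PF.sets_lim refl] by (rule measurable_restrict_subset) simp
  have u: "up_to {0..<n} \<le> n"
    by (simp add: up_to_iff)
  have "(\<integral>\<^sup>+\<omega>. f (restrict \<omega> {0..<n}) \<partial>PF.lim) = (\<integral>\<^sup>+\<omega>. f \<omega> \<partial>CI {0..<n})"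
    by (simp add: distr_lim[symmetric] nn_integral_distr[OF r])
  also have "\<dots> = (\<integral>\<^sup>+\<omega>. f \<omega> \<partial>C 0 n (\<lambda>_. undefined))"
  proof -
    \<comment> \<open>\<open>CI J\<close> runs the process up to \<open>up_to J\<close>, the least
      index beyond all of \<open>J\<close>, and restricts to \<open>J\<close>. For an initial
      segment nothing is cut off.\<close>
    have [simp]: "up_to {0..<n} = n"
      using u up_to_less[of "{0..<n}" "up_to {0..<n}"] by fastforce
    have m: "(\<lambda>\<omega>. restrict \<omega> {0..<n}) \<in> C 0 n (\<lambda>_. undefined) \<rightarrow>\<^sub>M PiM {0..<n} M"
      unfolding measurable_cong_sets[OF sets_C refl, of "\<lambda>_. undefined" 0, simplified]
      by (rule measurable_restrict_subset) simp
    show ?thesis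
      unfolding CI_def by (simp add: nn_integral_distr[OF m])
       (auto intro!: nn_integral_cong simp: space_C space_PiM)
  qed
  finally show ?thesis .
qed

text \<open>Passing to \<open>C 0 (Suc n)\<close> peels off the last kernel, and passing back turns
  \<open>C 0 n\<close> into the limit again. Both sides then live on the same trajectory space, so
  later arguments never mention finite horizons of the process.\<close>

lemma (in Ionescu_Tulcea) nn_integral_lim_component:
  assumes g[measurable]: "g \<in> borel_measurable (M n)"
  shows "(\<integral>\<^sup>+\<omega>. g (\<omega> n) \<partial>PF.lim) = (\<integral>\<^sup>+\<omega>. (\<integral>\<^sup>+z. g z \<partial>P n (restrict \<omega> {0..<n})) \<partial>PF.lim)"
proof -
  let ?C = "\<lambda>n. C 0 n (\<lambda>_. undefined)"
  have g': "(\<lambda>\<omega>. g (\<omega> n)) \<in> borel_measurable (PiM {0..<Suc n} M)"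
    by (rule measurable_compose[OF measurable_component_singleton[where M=M and i=n] g]) simp
  have "(\<integral>\<^sup>+\<omega>. g (\<omega> n) \<partial>PF.lim) = (\<integral>\<^sup>+\<omega>. g (restrict \<omega> {0..<Suc n} n) \<partial>PF.lim)"
    by simp
  also have "\<dots> = (\<integral>\<^sup>+\<omega>. g (\<omega> n) \<partial>?C (Suc n))"
    by (rule nn_integral_lim_restrict[OF g'])
  also have "\<dots> = (\<integral>\<^sup>+\<omega>. (\<integral>\<^sup>+\<omega>'. g (\<omega>' n) \<partial>eP n \<omega>) \<partial>?C n)"
    unfolding C.simps add_0
    by (rule nn_integral_bind[OF g']) (use measurable_eP in \<open>simp add: measurable_cong_sets[OF sets_C refl]\<close>)
  also have "\<dots> = (\<integral>\<^sup>+\<omega>. (\<integral>\<^sup>+z. g z \<partial>P n \<omega>) \<partial>?C n)"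
    by (intro nn_integral_cong) (simp add: space_C nn_integral_eP[OF _ g'])
  also have "\<dots> = (\<integral>\<^sup>+\<omega>. (\<integral>\<^sup>+z. g z \<partial>P n (restrict \<omega> {0..<n})) \<partial>PF.lim)"
    by (rule nn_integral_lim_restrict[symmetric])
       (rule measurable_compose[OF P nn_integral_measurable_subprob_algebra[OF g]])
  finally show ?thesis .
qed

section \<open>Bellman operator of a discounted MDP\<close>

locale discounted_mdp =
  fixes S :: "'s measure" and A :: "'a measure" and Q :: "'s \<times> 'a \<Rightarrow> 's measure"
    and c :: "'s \<times> 'a \<Rightarrow> ennreal" and \<gamma> :: real
  assumes Q: "Q \<in> S \<Otimes>\<^sub>M A \<rightarrow>\<^sub>M prob_algebra S"
    and c[measurable]: "c \<in> borel_measurable (S \<Otimes>\<^sub>M A)"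
    and \<gamma>_nonneg: "0 \<le> \<gamma>"
begin

text \<open>The first factor of \<open>step_kernel\<close>: the conditional law of the state at time
  \<open>t\<close>, before the action is drawn.\<close>

definition state_law :: "'s \<Rightarrow> nat \<Rightarrow> (nat \<Rightarrow> 's \<times> 'a) \<Rightarrow> 's measure" where
  "state_law s t \<omega> = (if t = 0 then return S s else Q (\<omega> (t - 1)))"

text \<open>The Q-function of \<open>v\<close>; its minimum over actions is the Bellman
  operator.\<close>

definition lookahead :: "('s \<Rightarrow> ennreal) \<Rightarrow> 's \<times> 'a \<Rightarrow> ennreal" where
  "lookahead v z = c z + ennreal \<gamma> * (\<integral>\<^sup>+ s. v s \<partial>Q z)"

text \<open>The expectation of \<open>v\<close> at the state of time \<open>t\<close>, taken through
  its conditional law. At time \<open>Suc t\<close> the inner integral is thus literally the one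
  against \<open>Q\<close> in \<open>lookahead\<close>.\<close>

definition expected_value :: "('s, 'a) policy \<Rightarrow> 's \<Rightarrow> nat \<Rightarrow> ('s \<Rightarrow> ennreal) \<Rightarrow> ennreal" where
  "expected_value \<pi> s t v =
    (\<integral>\<^sup>+\<omega>. (\<integral>\<^sup>+s'. v s' \<partial>state_law s t \<omega>) \<partial>trajectory_measure S A Q \<pi> s)"

lemma measurable_nn_integral_Q[measurable]:
  "v \<in> borel_measurable S \<Longrightarrow> (\<lambda>z. \<integral>\<^sup>+ s. v s \<partial>Q z) \<in> borel_measurable (S \<Otimes>\<^sub>M A)"
  by (rule measurable_compose[OF measurable_prob_algebraD[OF Q] nn_integral_measurable_subprob_algebra])

lemma measurable_lookahead[measurable]:
  "v \<in> borel_measurable S \<Longrightarrow> lookahead v \<in> borel_measurable (S \<Otimes>\<^sub>M A)"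
  unfolding lookahead_def[abs_def] by measurable

lemma lookahead_mono: "(\<And>s. v s \<le> w s) \<Longrightarrow> lookahead v z \<le> lookahead w z"
  unfolding lookahead_def by (intro add_left_mono mult_left_mono nn_integral_mono) auto

text \<open>Monotone convergence under \<open>Q z\<close>, then continuity of adding and of scaling
  by a finite factor. The form as a limit lets it be combined with
  \<open>tendsto_min\<close>.\<close>

lemma tendsto_lookahead_SUP:
  assumes inc: "incseq w" and w: "\<And>m. w m \<in> borel_measurable S" and z: "z \<in> space (S \<Otimes>\<^sub>M A)"
  shows "(\<lambda>m. lookahead (w m) z) \<longlonglongrightarrow> lookahead (\<lambda>s. SUP m. w m s) z"
proof -
  have sets_Q: "sets (Q z) = sets S"
    using measurable_space[OF Q z] by (simp add: space_prob_algebra)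
  have "incseq (\<lambda>m. \<integral>\<^sup>+ s. w m s \<partial>Q z)"
    using inc by (auto simp: incseq_def le_fun_def intro!: nn_integral_mono)
  from LIMSEQ_SUP[OF this] have "(\<lambda>m. \<integral>\<^sup>+ s. w m s \<partial>Q z) \<longlonglongrightarrow> (\<integral>\<^sup>+ s. (SUP m. w m s) \<partial>Q z)"
    using w by (subst nn_integral_monotone_convergence_SUP[OF inc])
      (auto simp: measurable_cong_sets[OF sets_Q refl])
  then show ?thesis
    unfolding lookahead_def by (intro tendsto_add tendsto_const ennreal_tendsto_cmult) auto
qed

text \<open>The algebra of one telescoping step: \<open>b\<close> is the cost accumulated so far,
  \<open>e\<close> the cost at stage \<open>n\<close>, \<open>d\<close> the expected
  continuation.\<close>

lemma discount_Suc:
  "b + ennreal (\<gamma> ^ n) * (e + ennreal \<gamma> * d) =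
    b + ennreal (\<gamma> ^ n) * e + ennreal (\<gamma> ^ Suc n) * d"
  using \<gamma>_nonneg by (simp add: distrib_left ennreal_mult ac_simps)

section \<open>Telescoping along the process of a policy\<close>

context
  fixes \<pi> s
  assumes \<pi>: "\<pi> \<in> policies S A" and s: "s \<in> space S"
begin

interpretation IT: Ionescu_Tulcea "step_kernel S A Q \<pi> s" "\<lambda>_. S \<Otimes>\<^sub>M A"
  using Q \<pi> s by (rule Ionescu_Tulcea_step_kernel)

abbreviation (input) "T \<equiv> trajectory_measure S A Q \<pi> s"

lemma sets_trajectory[measurable_cong]: "sets T = sets (PiM UNIV (\<lambda>_. S \<Otimes>\<^sub>M A))"
  by (simp add: trajectory_measure_def)

lemma prob_space_trajectory: "prob_space T"
proof
  \<comment> \<open>Horizon zero already gives the total mass.\<close>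
  have "(\<integral>\<^sup>+\<omega>. (\<lambda>_. 1) (restrict \<omega> {0..<0}) \<partial>T) = (\<integral>\<^sup>+\<omega>. 1 \<partial>IT.C 0 0 (\<lambda>_. undefined))"
    unfolding trajectory_measure_def by (rule IT.nn_integral_lim_restrict) simp
  then show "emeasure T (space T) = 1"
    using prob_space.emeasure_space_1[OF IT.prob_space_C[of "\<lambda>_. undefined" 0 0]] by simp
qed

lemma measurable_coordinate[measurable]: "(\<lambda>\<omega>. \<omega> t) \<in> T \<rightarrow>\<^sub>M S \<Otimes>\<^sub>M A"
  by measurable

lemma space_trajectoryD: "\<omega> \<in> space T \<Longrightarrow> \<omega> t \<in> space (S \<Otimes>\<^sub>M A)"
  using measurable_coordinate by (rule measurable_space)

lemma state_law_in: "\<omega> \<in> space T \<Longrightarrow> state_law s t \<omega> \<in> space (prob_algebra S)"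
  using measurable_space[OF Q space_trajectoryD] s
  by (auto simp: state_law_def space_prob_algebra prob_space_return)

lemma space_state_law: "\<omega> \<in> space T \<Longrightarrow> space (state_law s t \<omega>) = space S"
  using state_law_in by (auto simp: space_prob_algebra intro!: sets_eq_imp_space_eq)

lemma policy_in:
  assumes "\<omega> \<in> space T" "s' \<in> space S"
  shows "\<pi> t (restrict \<omega> {0..<t}, s') \<in> space (prob_algebra A)"
proof -
  have "(restrict \<omega> {0..<t}, s') \<in> space (history_space S A t)"
    using assms space_trajectoryD[OF assms(1)]
    by (auto simp: history_space_def space_pair_measure space_PiM)
  then show ?thesis
    using \<pi> by (auto simp: policies_def dest: measurable_space)
qed

text \<open>Conditioning on the past splits the draw at time \<open>t\<close> into a state from
  \<open>state_law\<close> and an action from the policy, as in \<open>step_kernel\<close>.\<close>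

lemma nn_integral_trajectory_component:
  assumes g[measurable]: "g \<in> borel_measurable (S \<Otimes>\<^sub>M A)"
  shows "(\<integral>\<^sup>+\<omega>. g (\<omega> t) \<partial>T) =
    (\<integral>\<^sup>+\<omega>. (\<integral>\<^sup>+s'. (\<integral>\<^sup>+a. g (s', a) \<partial>\<pi> t (restrict \<omega> {0..<t}, s')) \<partial>state_law s t \<omega>) \<partial>T)"
proof -
  have "(\<integral>\<^sup>+\<omega>. g (\<omega> t) \<partial>T) = (\<integral>\<^sup>+\<omega>. (\<integral>\<^sup>+z. g z \<partial>step_kernel S A Q \<pi> s t (restrict \<omega> {0..<t})) \<partial>T)"
    unfolding trajectory_measure_def by (rule IT.nn_integral_lim_component[OF g])
  also have "\<dots> = (\<integral>\<^sup>+\<omega>. (\<integral>\<^sup>+s'. (\<integral>\<^sup>+a. g (s', a) \<partial>\<pi> t (restrict \<omega> {0..<t}, s')) \<partial>state_law s t \<omega>) \<partial>T)"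
  proof (rule nn_integral_cong)
    fix \<omega> assume \<omega>: "\<omega> \<in> space T"
    let ?h = "restrict \<omega> {0..<t}"
    have h: "?h \<in> space (PiM {0..<t} (\<lambda>_. S \<Otimes>\<^sub>M A))"
      using space_trajectoryD[OF \<omega>] by (auto simp: space_PiM)
    \<comment> \<open>Only coordinate \<open>t - 1\<close> is read, and for positive
      \<open>t\<close> it survives the restriction to \<open>{0..<t}\<close>.\<close>
    have law: "(if t = 0 then return S s else Q (?h (t - 1))) = state_law s t \<omega>"
      by (auto simp: state_law_def)
    have sets_law: "sets (state_law s t \<omega>) = sets S"
      using state_law_in[OF \<omega>] by (simp add: space_prob_algebra)
    have pi: "\<pi> t \<in> PiM {0..<t} (\<lambda>_. S \<Otimes>\<^sub>M A) \<Otimes>\<^sub>M S \<rightarrow>\<^sub>M prob_algebra A"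
      using \<pi> by (auto simp: policies_def history_space_def)
    have pi_h: "(\<lambda>s'. \<pi> t (?h, s')) \<in> S \<rightarrow>\<^sub>M prob_algebra A"
      by (rule measurable_compose[OF _ pi]) (use h in measurable)
    have k: "(\<lambda>s'. \<pi> t (?h, s') \<bind> (\<lambda>a. return (S \<Otimes>\<^sub>M A) (s', a))) \<in> S \<rightarrow>\<^sub>M prob_algebra (S \<Otimes>\<^sub>M A)"
      by (rule measurable_bind_prob_space2[OF pi_h])
         (auto simp: case_prod_beta intro!: measurable_compose[OF _ measurable_return_prob_space])
    have "(\<integral>\<^sup>+z. g z \<partial>step_kernel S A Q \<pi> s t ?h) =
        (\<integral>\<^sup>+s'. (\<integral>\<^sup>+z. g z \<partial>(\<pi> t (?h, s') \<bind> (\<lambda>a. return (S \<Otimes>\<^sub>M A) (s', a)))) \<partial>state_law s t \<omega>)"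
      unfolding step_kernel_def law
      by (rule nn_integral_bind[OF g])
         (use measurable_prob_algebraD[OF k] in \<open>simp add: measurable_cong_sets[OF sets_law refl]\<close>)
    also have "\<dots> = (\<integral>\<^sup>+s'. (\<integral>\<^sup>+a. g (s', a) \<partial>\<pi> t (?h, s')) \<partial>state_law s t \<omega>)"
    proof (rule nn_integral_cong)
      fix s' assume "s' \<in> space (state_law s t \<omega>)"
      then have s': "s' \<in> space S"
        using sets_eq_imp_space_eq[OF sets_law] by simp
      have sets_pi: "sets (\<pi> t (?h, s')) = sets A"
        using policy_in[OF \<omega> s'] by (simp add: space_prob_algebra)
      have r: "(\<lambda>a. return (S \<Otimes>\<^sub>M A) (s', a)) \<in> \<pi> t (?h, s') \<rightarrow>\<^sub>M subprob_algebra (S \<Otimes>\<^sub>M A)"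
        unfolding measurable_cong_sets[OF sets_pi refl]
        by (rule measurable_compose[OF _ return_measurable]) (use s' in measurable)
      show "(\<integral>\<^sup>+z. g z \<partial>(\<pi> t (?h, s') \<bind> (\<lambda>a. return (S \<Otimes>\<^sub>M A) (s', a)))) =
          (\<integral>\<^sup>+a. g (s', a) \<partial>\<pi> t (?h, s'))"
        unfolding nn_integral_bind[OF g r]
        by (intro nn_integral_cong nn_integral_return g)
           (use s' sets_eq_imp_space_eq[OF sets_pi] in \<open>auto simp: space_pair_measure\<close>)
    qed
    finally show "(\<integral>\<^sup>+z. g z \<partial>step_kernel S A Q \<pi> s t ?h) =
        (\<integral>\<^sup>+s'. (\<integral>\<^sup>+a. g (s', a) \<partial>\<pi> t (?h, s')) \<partial>state_law s t \<omega>)" .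
  qed
  finally show ?thesis .
qed

lemma expected_value_0:
  assumes "v \<in> borel_measurable S"
  shows "expected_value \<pi> s 0 v = v s"
  using prob_space.emeasure_space_1[OF prob_space_trajectory]
  by (simp add: expected_value_def state_law_def nn_integral_return[OF s assms])

lemma nn_integral_lookahead:
  assumes [measurable]: "v \<in> borel_measurable S"
  shows "(\<integral>\<^sup>+\<omega>. lookahead v (\<omega> t) \<partial>T) =
    (\<integral>\<^sup>+\<omega>. c (\<omega> t) \<partial>T) + ennreal \<gamma> * expected_value \<pi> s (Suc t) v"
  unfolding lookahead_def
  by (subst nn_integral_add) (auto simp: nn_integral_cmult expected_value_def state_law_def)

text \<open>A lower bound for every action is also one for the average over a randomized action,
  because the policy gives probability measures.\<close>

lemma expected_value_le:
  assumes v: "v \<in> borel_measurable S"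
    and le: "\<And>s' a. s' \<in> space S \<Longrightarrow> a \<in> space A \<Longrightarrow> w s' \<le> lookahead v (s', a)"
  shows "expected_value \<pi> s t w \<le> (\<integral>\<^sup>+\<omega>. c (\<omega> t) \<partial>T) + ennreal \<gamma> * expected_value \<pi> s (Suc t) v"
proof -
  have "w s' \<le> (\<integral>\<^sup>+a. lookahead v (s', a) \<partial>\<pi> t (restrict \<omega> {0..<t}, s'))"
    if \<omega>: "\<omega> \<in> space T" and s': "s' \<in> space S" for \<omega> s'
  proof -
    let ?p = "\<pi> t (restrict \<omega> {0..<t}, s')"
    have p: "prob_space ?p" "sets ?p = sets A"
      using policy_in[OF \<omega> s'] by (auto simp: space_prob_algebra)
    have "w s' = (\<integral>\<^sup>+a. w s' \<partial>?p)"
      using prob_space.emeasure_space_1[OF p(1)] by simp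
    also have "\<dots> \<le> (\<integral>\<^sup>+a. lookahead v (s', a) \<partial>?p)"
      using sets_eq_imp_space_eq[OF p(2)] by (intro nn_integral_mono le s') simp
    finally show ?thesis .
  qed
  then have "expected_value \<pi> s t w \<le> (\<integral>\<^sup>+\<omega>. lookahead v (\<omega> t) \<partial>T)"
    unfolding expected_value_def nn_integral_trajectory_component[OF measurable_lookahead[OF v]]
    by (intro nn_integral_mono) (simp add: space_state_law)
  then show ?thesis
    by (simp add: nn_integral_lookahead[OF v])
qed

lemma policy_cost_eq_suminf:
  "policy_cost S A Q c \<gamma> \<pi> s = (\<Sum>t. ennreal (\<gamma> ^ t) * (\<integral>\<^sup>+\<omega>. c (\<omega> t) \<partial>T))"
  unfolding policy_cost_def by (subst nn_integral_suminf) (auto simp: nn_integral_cmult)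

text \<open>\<open>w N\<close> is a lower bound for the cost of the first \<open>N\<close> stages,
  and costs from stage \<open>N\<close> on are nonnegative.\<close>

lemma value_iteration_le_policy_cost:
  assumes w: "\<And>m. w m \<in> borel_measurable S"
    and w0: "\<And>s'. w 0 s' = 0"
    and le: "\<And>m s' a. s' \<in> space S \<Longrightarrow> a \<in> space A \<Longrightarrow> w (Suc m) s' \<le> lookahead (w m) (s', a)"
  shows "w N s \<le> policy_cost S A Q c \<gamma> \<pi> s"
proof -
  let ?c = "\<lambda>t. ennreal (\<gamma> ^ t) * (\<integral>\<^sup>+\<omega>. c (\<omega> t) \<partial>T)"
  \<comment> \<open>The index of the iterate is the remaining horizon: it drops by one with each
    stage paid for, so at \<open>n = N\<close> the continuation is \<open>w 0 = 0\<close>.\<close>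
  have "w N s \<le> (\<Sum>t<n. ?c t) + ennreal (\<gamma> ^ n) * expected_value \<pi> s n (w (N - n))" if "n \<le> N" for n
    using that
  proof (induction n)
    case 0
    then show ?case by (simp add: expected_value_0[OF w])
  next
    case (Suc n)
    then have N: "N - n = Suc (N - Suc n)" by simp
    have "w N s \<le> (\<Sum>t<n. ?c t) + ennreal (\<gamma> ^ n) * expected_value \<pi> s n (w (N - n))"
      using Suc by simp
    also have "\<dots> \<le> (\<Sum>t<n. ?c t) + ennreal (\<gamma> ^ n) *
        ((\<integral>\<^sup>+\<omega>. c (\<omega> n) \<partial>T) + ennreal \<gamma> * expected_value \<pi> s (Suc n) (w (N - Suc n)))"
      unfolding N by (intro add_left_mono mult_left_mono expected_value_le w le) auto
    finally show ?case
      unfolding discount_Suc by simp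
  qed
  from this[of N] have "w N s \<le> (\<Sum>t<N. ?c t)"
    by (simp add: expected_value_def w0)
  also have "\<dots> \<le> (\<Sum>t. ?c t)"
    by (rule sum_le_suminf) auto
  finally show ?thesis
    by (simp add: policy_cost_eq_suminf)
qed

end

text \<open>The action is drawn from a Dirac measure, so \<open>ge\<close> holds along the process
  and says that \<open>v\<close> covers the current cost plus the discounted continuation. Iterating
  it bounds all partial sums.\<close>

lemma stationary_policy_cost_le:
  assumes \<phi>: "\<phi> \<in> S \<rightarrow>\<^sub>M A" and s: "s \<in> space S" and v: "v \<in> borel_measurable S"
    and ge: "\<And>s'. s' \<in> space S \<Longrightarrow> lookahead v (s', \<phi> s') \<le> v s'"
  shows "policy_cost S A Q c \<gamma> (stationary_policy A \<phi>) s \<le> v s"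
proof -
  let ?\<pi> = "stationary_policy A \<phi>"
  have \<pi>: "?\<pi> \<in> policies S A"
    using \<phi> by (rule stationary_policy_in_policies)
  let ?T = "trajectory_measure S A Q ?\<pi> s"
  let ?c = "\<lambda>t. ennreal (\<gamma> ^ t) * (\<integral>\<^sup>+\<omega>. c (\<omega> t) \<partial>?T)"
  let ?E = "expected_value ?\<pi> s"
  have step: "(\<integral>\<^sup>+\<omega>. c (\<omega> t) \<partial>?T) + ennreal \<gamma> * ?E (Suc t) v \<le> ?E t v" for t
  proof -
    have "(\<integral>\<^sup>+a. lookahead v (s', a) \<partial>?\<pi> t (h, s')) \<le> v s'" if s': "s' \<in> space S" for s' h
    proof -
      have "(\<integral>\<^sup>+a. lookahead v (s', a) \<partial>return A (\<phi> s')) = lookahead v (s', \<phi> s')"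
        using measurable_lookahead[OF v] s' measurable_space[OF \<phi> s'] by (intro nn_integral_return) auto
      then show ?thesis
        using ge[OF s'] by (simp add: stationary_policy_def)
    qed
    then have "(\<integral>\<^sup>+\<omega>. lookahead v (\<omega> t) \<partial>?T) \<le> ?E t v"
      unfolding expected_value_def
        nn_integral_trajectory_component[OF \<pi> s measurable_lookahead[OF v]]
      by (intro nn_integral_mono) (simp add: space_state_law[OF \<pi> s])
    then show ?thesis
      by (simp add: nn_integral_lookahead[OF \<pi> s v])
  qed
  have "(\<Sum>t<n. ?c t) + ennreal (\<gamma> ^ n) * ?E n v \<le> v s" for n
  proof (induction n)
    case 0
    then show ?case by (simp add: expected_value_0[OF \<pi> s v])
  next
    case (Suc n)
    have "(\<Sum>t<Suc n. ?c t) + ennreal (\<gamma> ^ Suc n) * ?E (Suc n) v =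
        (\<Sum>t<n. ?c t) + ennreal (\<gamma> ^ n) * ((\<integral>\<^sup>+\<omega>. c (\<omega> n) \<partial>?T) + ennreal \<gamma> * ?E (Suc n) v)"
      unfolding discount_Suc by simp
    also have "\<dots> \<le> (\<Sum>t<n. ?c t) + ennreal (\<gamma> ^ n) * ?E n v"
      by (intro add_left_mono mult_left_mono step) auto
    also have "\<dots> \<le> v s"
      by (rule Suc)
    finally show ?case .
  qed
  \<comment> \<open>The terminal term is nonnegative and is simply dropped, so it does not have to
    vanish as \<open>n\<close> grows.\<close>
  then have "(\<Sum>t<n. ?c t) \<le> v s" for n
    using order_trans[OF add_increasing2[OF zero_le order_refl]] by blast
  then show ?thesis
    unfolding policy_cost_eq_suminf[OF \<pi> s] suminf_eq_SUP by (intro SUP_least)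
qed

end


section \<open>The restart model: running cost and one-step values\<close>

locale restart_mdp =
  fixes M :: "'x measure" and P :: "'x \<Rightarrow> 'x measure" and \<nu> :: "'x measure"
    and F :: "'x \<Rightarrow> ennreal" and G :: "action \<Rightarrow> real" and \<gamma> :: real
  assumes P: "P \<in> M \<rightarrow>\<^sub>M prob_algebra M"
    and \<nu>: "\<nu> \<in> space (prob_algebra M)"
    and F: "F \<in> borel_measurable M"
    and discount_nonneg: "0 \<le> \<gamma>"
    and F_le: "\<And>x. x \<in> space M \<Longrightarrow> F x \<le> (\<integral>\<^sup>+ y. F y \<partial>P x)"
begin

abbreviation running_cost :: "nat \<Rightarrow> 'x \<Rightarrow> ennreal" where
  "running_cost k x \<equiv> \<integral>\<^sup>+ y. F y \<partial>kernel_power M P k x"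

lemma measurable_kernel_power: "kernel_power M P k \<in> M \<rightarrow>\<^sub>M prob_algebra M"
proof (induction k)
  case 0
  then show ?case
    using measurable_return_prob_space by (simp cong: measurable_cong)
next
  case (Suc k)
  have "(\<lambda>x. kernel_power M P k x \<bind> P) \<in> M \<rightarrow>\<^sub>M prob_algebra M"
    by (rule measurable_bind_prob_space[OF Suc P])
  then show ?case
    by simp
qed

lemma measurable_running_cost: "running_cost k \<in> borel_measurable M"
  by (rule measurable_compose[OF measurable_prob_algebraD[OF measurable_kernel_power]
        nn_integral_measurable_subprob_algebra[OF F]])

text \<open>\<open>kernel_power\<close> appends the new \<open>P\<close> on the right, so the next
  running cost is the integral of \<open>PF\<close> under the old kernel, and \<open>F_le\<close>
  applies under that integral.\<close>

lemma running_cost_Suc: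
  assumes x: "x \<in> space M"
  shows "running_cost k x \<le> running_cost (Suc k) x"
proof -
  have sets: "sets (kernel_power M P k x) = sets M"
    using measurable_space[OF measurable_kernel_power x] by (simp add: space_prob_algebra)
  have "running_cost k x \<le> (\<integral>\<^sup>+ y. (\<integral>\<^sup>+ y'. F y' \<partial>P y) \<partial>kernel_power M P k x)"
    using sets_eq_imp_space_eq[OF sets] by (intro nn_integral_mono F_le) simp
  also have "\<dots> = running_cost (Suc k) x"
    using measurable_prob_algebraD[OF P] unfolding kernel_power.simps
    by (intro nn_integral_bind[OF F, symmetric]) (simp add: measurable_cong_sets[OF sets refl])
  finally show ?thesis .
qed

lemma measurable_restart_cost:
  "restart_cost M P F G \<in> borel_measurable (restart_states M \<Otimes>\<^sub>M restart_actions)"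
proof -
  \<comment> \<open>The time component is countable, so it suffices to have measurability for each
    fixed \<open>k\<close>.\<close>
  have "(\<lambda>z. running_cost (snd (fst z)) (fst (fst z))) \<in> borel_measurable (restart_states M \<Otimes>\<^sub>M restart_actions)"
    by (rule measurable_compose_countable[where f="\<lambda>k z. running_cost k (fst (fst z))"])
       (rule measurable_compose[OF _ measurable_running_cost], measurable)
  moreover have "(\<lambda>z. ennreal (G (snd z))) \<in> borel_measurable (restart_states M \<Otimes>\<^sub>M restart_actions)"
    by (rule measurable_compose[OF measurable_snd]) simp
  ultimately have "(\<lambda>z. running_cost (snd (fst z)) (fst (fst z)) + ennreal (G (snd z)))
      \<in> borel_measurable (restart_states M \<Otimes>\<^sub>M restart_actions)"
    by simp
  also have "(\<lambda>z. running_cost (snd (fst z)) (fst (fst z)) + ennreal (G (snd z))) = restart_cost M P F G"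
    by (auto simp: fun_eq_iff)
  finally show ?thesis .
qed

sublocale discounted_mdp "restart_states M" restart_actions "restart_kernel M \<nu>" "restart_cost M P F G" \<gamma>
  using restart_kernel_measurable[OF \<nu>] measurable_restart_cost discount_nonneg
  by unfold_locales

text \<open>The running cost is split off so that the two actions differ only in the bracket, which
  is what \<open>threshold_rule\<close> compares.\<close>

lemma lookahead_No_Intervention:
  assumes x: "x \<in> space M" and v[measurable]: "v \<in> borel_measurable (restart_states M)"
  shows "lookahead v ((x, k), No_Intervention) =
    running_cost k x + (ennreal (G No_Intervention) + ennreal \<gamma> * v (x, Suc k))"
proof -
  let ?N = "return (count_space UNIV) (Suc k)"
  interpret N: prob_space ?N
    by (rule prob_space_return) simp
  have m: "v \<in> borel_measurable (return M x \<Otimes>\<^sub>M ?N)"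
    by (subst measurable_cong_sets[OF sets_pair_measure_cong[OF sets_return sets_return] refl]) (rule v)
  have "(\<integral>\<^sup>+ s. v s \<partial>(return M x \<Otimes>\<^sub>M ?N)) = v (x, Suc k)"
    unfolding N.nn_integral_fst[OF m, symmetric]
    using x by (simp add: nn_integral_return)
  then show ?thesis
    by (simp add: lookahead_def add.assoc)
qed

text \<open>A restart forgets the state, so the bracket is the same for all \<open>x\<close> and
  \<open>k\<close>.\<close>

lemma lookahead_Restart:
  assumes v[measurable]: "v \<in> borel_measurable (restart_states M)"
  shows "lookahead v ((x, k), Restart) =
    running_cost k x + (ennreal (G Restart) + ennreal \<gamma> * (\<integral>\<^sup>+ y. v (y, 0) \<partial>\<nu>))"
proof -
  let ?N = "return (count_space UNIV) (0 :: nat)"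
  interpret N: prob_space ?N
    by (rule prob_space_return) simp
  have sets: "sets \<nu> = sets M"
    using \<nu> by (simp add: space_prob_algebra)
  have m: "v \<in> borel_measurable (\<nu> \<Otimes>\<^sub>M ?N)"
    by (subst measurable_cong_sets[OF sets_pair_measure_cong[OF sets sets_return] refl]) (rule v)
  have "(\<integral>\<^sup>+ s. v s \<partial>(\<nu> \<Otimes>\<^sub>M ?N)) = (\<integral>\<^sup>+ y. v (y, 0) \<partial>\<nu>)"
    unfolding N.nn_integral_fst[OF m, symmetric]
    by (simp add: nn_integral_return)
  then show ?thesis
    by (simp add: lookahead_def add.assoc)
qed

section \<open>Value iteration and its limit\<close>

primrec value_iterate :: "nat \<Rightarrow> 'x \<times> nat \<Rightarrow> ennreal" where
  "value_iterate 0 s = 0"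
| "value_iterate (Suc m) s =
    min (lookahead (value_iterate m) (s, No_Intervention)) (lookahead (value_iterate m) (s, Restart))"

definition limit_value :: "'x \<times> nat \<Rightarrow> ennreal" where
  "limit_value s = (SUP m. value_iterate m s)"

lemma measurable_value_iterate[measurable]: "value_iterate m \<in> borel_measurable (restart_states M)"
proof (induction m)
  case 0
  then show ?case
    by (simp cong: measurable_cong)
next
  case (Suc m)
  note measurable_lookahead[OF Suc, measurable]
  have "(\<lambda>s. min (lookahead (value_iterate m) (s, No_Intervention)) (lookahead (value_iterate m) (s, Restart)))
      \<in> borel_measurable (restart_states M)"
    by measurable
  then show ?case
    by simp
qed

lemma measurable_limit_value[measurable]: "limit_value \<in> borel_measurable (restart_states M)"
  unfolding limit_value_def[abs_def] by measurable

lemma incseq_value_iterate: "incseq value_iterate"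
proof (rule incseq_SucI, rule le_funI)
  show "value_iterate m s \<le> value_iterate (Suc m) s" for m s
  proof (induction m arbitrary: s)
    case (Suc m)
    then show ?case
      unfolding value_iterate.simps(2) by (intro min.mono lookahead_mono)
  qed simp
qed

text \<open>Running costs grow by \<open>running_cost_Suc\<close>, the restart bracket is constant,
  and the waiting bracket grows by induction, used at \<open>Suc k\<close>.\<close>

lemma value_iterate_mono_time:
  assumes x: "x \<in> space M"
  shows "value_iterate m (x, k) \<le> value_iterate m (x, Suc k)"
proof (induction m arbitrary: k)
  case (Suc m)
  show ?case
    unfolding value_iterate.simps(2) lookahead_Restart[OF measurable_value_iterate]
      lookahead_No_Intervention[OF x measurable_value_iterate]
    by (intro min.mono add_mono mult_left_mono running_cost_Suc x Suc) auto
qed simp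

lemma limit_value_mono_time:
  assumes x: "x \<in> space M" and "j \<le> k"
  shows "limit_value (x, j) \<le> limit_value (x, k)"
  unfolding limit_value_def
  by (intro SUP_mono')
     (rule lift_Suc_mono_le[where f="\<lambda>k. value_iterate m (x, k)" for m, OF value_iterate_mono_time[OF x] \<open>j \<le> k\<close>])

section \<open>Optimality equation and greedy rule\<close>

text \<open>Both sides are limits of the shifted iterates: the left by monotone convergence, the
  right because a minimum of two convergent sequences converges to the minimum of the
  limits.\<close>

lemma limit_value_fixed_point:
  assumes s: "s \<in> space (restart_states M)"
  shows "limit_value s = min (lookahead limit_value (s, No_Intervention)) (lookahead limit_value (s, Restart))"
proof (rule LIMSEQ_unique)
  have "(\<lambda>m. value_iterate m s) \<longlonglongrightarrow> limit_value s"
    unfolding limit_value_def using incseq_value_iterate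
    by (intro LIMSEQ_SUP) (simp add: incseq_def le_fun_def del: split_paired_All)
  then show "(\<lambda>m. value_iterate (Suc m) s) \<longlonglongrightarrow> limit_value s"
    by (rule LIMSEQ_Suc)
  have "(\<lambda>m. lookahead (value_iterate m) (s, a)) \<longlonglongrightarrow> lookahead limit_value (s, a)" for a
    using tendsto_lookahead_SUP[OF incseq_value_iterate measurable_value_iterate, of "(s, a)"] s
    by (simp add: limit_value_def[abs_def] space_pair_measure)
  then show "(\<lambda>m. value_iterate (Suc m) s) \<longlonglongrightarrow>
      min (lookahead limit_value (s, No_Intervention)) (lookahead limit_value (s, Restart))"
    unfolding value_iterate.simps(2) by (intro tendsto_min)
qed

text \<open>The running cost is left out of the comparison of the two actions: where it is infinite it
  would make every action greedy and could destroy the threshold structure.\<close>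

definition threshold_rule :: "'x \<times> nat \<Rightarrow> action" where
  "threshold_rule s =
    (if ennreal (G Restart) + ennreal \<gamma> * (\<integral>\<^sup>+ y. limit_value (y, 0) \<partial>\<nu>)
        \<le> ennreal (G No_Intervention) + ennreal \<gamma> * limit_value (fst s, Suc (snd s))
     then Restart else No_Intervention)"

lemma measurable_threshold_rule: "threshold_rule \<in> restart_states M \<rightarrow>\<^sub>M restart_actions"
  unfolding threshold_rule_def[abs_def] by measurable

text \<open>Adding the common running cost preserves the order of the brackets, so the chosen action
  attains the minimum. Where that cost is infinite, both actions attain it.\<close>

lemma lookahead_threshold_rule:
  assumes s: "s \<in> space (restart_states M)"
  shows "lookahead limit_value (s, threshold_rule s) = limit_value s"
proof -
  obtain x k where "s = (x, k)" and x: "x \<in> space M"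
    using s by (auto simp: space_pair_measure)
  then show ?thesis
    unfolding limit_value_fixed_point[OF s]
    by (auto simp: threshold_rule_def lookahead_No_Intervention lookahead_Restart min_def
        intro: antisym add_left_mono)
qed

text \<open>\<open>limit_value\<close> lies above the cost of this rule and below the cost of every
  policy.\<close>

lemma optimal_threshold_rule:
  "optimal_policy (restart_states M) restart_actions (restart_kernel M \<nu>) (restart_cost M P F G) \<gamma>
    (stationary_policy restart_actions threshold_rule)"
  unfolding optimal_policy_def
proof (intro conjI ballI antisym)
  show pol: "stationary_policy restart_actions threshold_rule \<in> policies (restart_states M) restart_actions"
    by (rule stationary_policy_in_policies[OF measurable_threshold_rule])
  fix s assume s: "s \<in> space (restart_states M)"
  show "policy_cost (restart_states M) restart_actions (restart_kernel M \<nu>) (restart_cost M P F G) \<gamma>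
      (stationary_policy restart_actions threshold_rule) s
    \<le> optimal_cost (restart_states M) restart_actions (restart_kernel M \<nu>) (restart_cost M P F G) \<gamma> s"
    unfolding optimal_cost_def
  proof (rule INF_greatest)
    fix \<pi> :: "('x \<times> nat, action) policy"
    assume \<pi>: "\<pi> \<in> policies (restart_states M) restart_actions"
    have "policy_cost (restart_states M) restart_actions (restart_kernel M \<nu>) (restart_cost M P F G) \<gamma>
        (stationary_policy restart_actions threshold_rule) s \<le> limit_value s"
      by (rule stationary_policy_cost_le[OF measurable_threshold_rule s measurable_limit_value])
         (simp add: lookahead_threshold_rule)
    also have "\<dots> \<le> policy_cost (restart_states M) restart_actions (restart_kernel M \<nu>)
        (restart_cost M P F G) \<gamma> \<pi> s"
      unfolding limit_value_def
    proof (intro SUP_least value_iteration_le_policy_cost[OF \<pi> s] measurable_value_iterate)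
      show "value_iterate (Suc m) s' \<le> lookahead (value_iterate m) (s', a)" for m s' a
        by (cases a) auto
    qed simp
    finally show "policy_cost (restart_states M) restart_actions (restart_kernel M \<nu>) (restart_cost M P F G) \<gamma>
        (stationary_policy restart_actions threshold_rule) s
      \<le> policy_cost (restart_states M) restart_actions (restart_kernel M \<nu>) (restart_cost M P F G) \<gamma> \<pi> s" .
  qed
  show "optimal_cost (restart_states M) restart_actions (restart_kernel M \<nu>) (restart_cost M P F G) \<gamma> s
    \<le> policy_cost (restart_states M) restart_actions (restart_kernel M \<nu>) (restart_cost M P F G) \<gamma>
      (stationary_policy restart_actions threshold_rule) s"
    unfolding optimal_cost_def using pol by (rule INF_lower)
qed

section \<open>Threshold structure of the restart region\<close>

text \<open>In the comparison defining the rule, the restart side does not depend on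
  \<open>k\<close> while the waiting side is nondecreasing in it.\<close>

lemma restart_region_upward_closed:
  assumes x: "x \<in> space M" and "j \<le> k" and "threshold_rule (x, j) = Restart"
  shows "threshold_rule (x, k) = Restart"
proof -
  have "ennreal (G Restart) + ennreal \<gamma> * (\<integral>\<^sup>+ y. limit_value (y, 0) \<partial>\<nu>)
      \<le> ennreal (G No_Intervention) + ennreal \<gamma> * limit_value (x, Suc j)"
    using assms(3) by (simp add: threshold_rule_def split: if_splits)
  also have "\<dots>
      \<le> ennreal (G No_Intervention) + ennreal \<gamma> * limit_value (x, Suc k)"
    using \<open>j \<le> k\<close> by (intro add_left_mono mult_left_mono limit_value_mono_time x) auto
  finally show ?thesis
    by (simp add: threshold_rule_def)
qed

lemma restart_region_tail:
  assumes x: "x \<in> space M"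
  shows "{k. threshold_rule (x, k) = Restart} = {} \<or> (\<exists>j. {k. threshold_rule (x, k) = Restart} = {j..})"
proof (cases "\<exists>k. threshold_rule (x, k) = Restart")
  case True
  \<comment> \<open>A nonempty upward closed set of naturals is the tail from its least
    element.\<close>
  define j where "j = (LEAST k. threshold_rule (x, k) = Restart)"
  have "threshold_rule (x, j) = Restart"
    unfolding j_def using True by (rule LeastI_ex)
  then have "{k. threshold_rule (x, k) = Restart} = {j..}"
    by (auto intro: restart_region_upward_closed[OF x]) (simp add: j_def Least_le)
  then show ?thesis
    by blast
qed simp

end

theorem theorem1:
  fixes X :: "'x::polish_space set"
    and M :: "'x measure"
    and P :: "'x \<Rightarrow> 'x measure"
    and \<nu> :: "'x measure"
    and F :: "'x \<Rightarrow> ennreal"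
    and G :: "action \<Rightarrow> real"
    and \<gamma> :: real
  assumes "X \<in> sets borel"
    and "M = restrict_space borel X"
    and "P \<in> M \<rightarrow>\<^sub>M prob_algebra M"
    and "\<nu> \<in> space (prob_algebra M)"
    and "F \<in> borel_measurable M"
    and "\<And>a. 0 \<le> G a"
    and "\<And>x. x \<in> X \<Longrightarrow> F x \<le> (\<integral>\<^sup>+ y. F y \<partial>P x)"
    and "0 < \<gamma>" and "\<gamma> \<le> 1"
  shows "\<exists>\<phi>. \<phi> \<in> restart_states M \<rightarrow>\<^sub>M restart_actions \<and>
    optimal_policy (restart_states M) restart_actions (restart_kernel M \<nu>) (restart_cost M P F G) \<gamma>
      (stationary_policy restart_actions \<phi>) \<and>
    (\<forall>x\<in>X. \<exists>kstar :: enat. \<forall>k :: nat.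
       \<phi> (x, k) = (if kstar \<le> enat k then Restart else No_Intervention)) \<and>
    (\<forall>x\<in>X. {k. \<phi> (x, k) = Restart} = {} \<or> (\<exists>j. {k. \<phi> (x, k) = Restart} = {j..}))"
proof -
  have space_M: "space M = X"
    using assms(2) by (simp add: space_restrict_space)
  interpret restart_mdp M P \<nu> F G \<gamma>
    using assms(3-5,7,8) by unfold_locales (simp_all add: space_M)
  have threshold: "\<exists>kstar :: enat. \<forall>k. threshold_rule (x, k) = (if kstar \<le> enat k then Restart else No_Intervention)"
    if x: "x \<in> X" for x
  proof -
    have No: "threshold_rule (x, k) = No_Intervention \<longleftrightarrow> threshold_rule (x, k) \<noteq> Restart" for k
      by (cases "threshold_rule (x, k)") auto
    consider "{k. threshold_rule (x, k) = Restart} = {}"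
      | j where "{k. threshold_rule (x, k) = Restart} = {j..}"
      using restart_region_tail[of x, unfolded space_M, OF x] by blast
    then show ?thesis
    proof cases
      case 1
      \<comment> \<open>The infinite threshold encodes a ray on which no restart ever
        happens.\<close>
      then show ?thesis by (intro exI[of _ \<infinity>]) (simp add: No)
    next
      case 2
      then show ?thesis by (intro exI[of _ "enat j"]) (simp add: No set_eq_iff)
    qed
  qed
  show ?thesis
    using measurable_threshold_rule optimal_threshold_rule threshold restart_region_tail
    by (intro exI[of _ threshold_rule]) (simp add: space_M)
qed

end
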